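(* For every $n\in\mathbb N$, $H^+\not\leq H^{(n)}$.
   Context: A ceer is an equivalence relation on $\mathbb N$ c.e. as a subset of $\mathbb N^2$; $R_1\leq R_2$ means there is a total computable $f$ with $xR_1y\Leftrightarrow f(x)R_2f(y)$. With $\varphi_e$ the standard enumeration of partial computable functions, $xHy\Leftrightarrow x=y\lor\varphi_x(x)\!\downarrow\,=\varphi_y(y)\!\downarrow$. The halting jump of a ceer $E$ is $xE'y\Leftrightarrow x=y\lor(\varphi_x(x)\!\downarrow,\varphi_y(y)\!\downarrow,\ \varphi_x(x)E\varphi_y(y))$, with $E^{(0)}=E$, $E^{(n+1)}=(E^{(n)})'$. The saturation jump $E^+$ is the equivalence relation on finite subsets of $\mathbb N$ (identified with $\mathbb N$ via a fixed computable bijection) given by $xE^+y\Leftrightarrow[x]_E=[y]_E$, where $[X]_E=\{y:\exists x\in X\,(xEy)\}$. *)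

theory Defs
  imports Main "HOL-Library.Nat_Bijection"
begin

text \<open>
  Partial computable functions are the partial recursive functions of one argument; several
  arguments are passed as one number by means of the Cantor pairing function \<open>prod_encode\<close>.
  The identity is \<open>PairP Fst Snd\<close>.
\<close>

datatype prog =
    Zero
  | Succ
  | Fst
  | Snd
  | PairP prog prog
  | Comp prog prog
  | PrimRec prog prog
  | Mu prog

text \<open>
  \<open>None\<close> means divergence. All arguments of a composition or pairing have to converge, and an
  unbounded search for the least zero diverges if some value before the first zero does.
\<close>

primrec prog_sem :: "prog \<Rightarrow> nat \<Rightarrow> nat option" where
  "prog_sem Zero = (\<lambda>x. Some 0)"
| "prog_sem Succ = (\<lambda>x. Some (Suc x))"
| "prog_sem Fst = (\<lambda>x. Some (fst (prod_decode x)))"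
| "prog_sem Snd = (\<lambda>x. Some (snd (prod_decode x)))"
| "prog_sem (PairP p q) =
     (\<lambda>x. Option.bind (prog_sem p x) (\<lambda>a. Option.bind (prog_sem q x) (\<lambda>b. Some (prod_encode (a, b)))))"
| "prog_sem (Comp p q) = (\<lambda>x. Option.bind (prog_sem q x) (prog_sem p))"
| "prog_sem (PrimRec p q) =
     (\<lambda>x. case prod_decode x of (a, n) \<Rightarrow>
        rec_nat (prog_sem p a)
          (\<lambda>i r. Option.bind r (\<lambda>v. prog_sem q (prod_encode (a, prod_encode (i, v))))) n)"
| "prog_sem (Mu p) =
     (\<lambda>x. if \<exists>n. prog_sem p (prod_encode (x, n)) = Some 0
               \<and> (\<forall>m<n. prog_sem p (prod_encode (x, m)) \<noteq> None)
          then Some (LEAST n. prog_sem p (prod_encode (x, n)) = Some 0)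
          else None)"

primrec goedel :: "prog \<Rightarrow> nat" where
  "goedel Zero = 0"
| "goedel Succ = 1"
| "goedel Fst = 2"
| "goedel Snd = 3"
| "goedel (PairP p q) = 4 + 4 * prod_encode (goedel p, goedel q)"
| "goedel (Comp p q) = 5 + 4 * prod_encode (goedel p, goedel q)"
| "goedel (PrimRec p q) = 6 + 4 * prod_encode (goedel p, goedel q)"
| "goedel (Mu p) = 7 + 4 * goedel p"

lemma inj_goedel: "inj goedel"
proof (rule injI)
  fix p q
  show "goedel p = goedel q \<Longrightarrow> p = q"
  proof (induction p arbitrary: q)
    case Zero then show ?case by (cases q) auto
  next
    case Succ then show ?case by (cases q) auto
  next
    case Fst then show ?case by (cases q) auto
  next
    case Snd then show ?case by (cases q) auto
  next
    case (PairP p1 p2) then show ?case by (cases q) (auto, presburger+)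
  next
    case (Comp p1 p2) then show ?case by (cases q) (auto, presburger+)
  next
    case (PrimRec p1 p2) then show ?case by (cases q) (auto, presburger+)
  next
    case (Mu p) then show ?case by (cases q) (auto, presburger+)
  qed
qed

lemma surj_goedel: "surj goedel"
proof -
  have "\<exists>p. goedel p = n" for n
  proof (induction n rule: less_induct)
    case (less n)
    show ?case
    proof (cases "n < 4")
      case True
      then consider "n = 0" | "n = 1" | "n = 2" | "n = 3" by linarith
      then show ?thesis by cases (metis goedel.simps)+
    next
      case False
      define k where "k = (n - 4) div 4"
      obtain a b where ab: "k = prod_encode (a, b)" by (metis prod_decode_inverse surj_pair)
      have k: "k < n" using False unfolding k_def by linarith
      have "a < n" "b < n"
        using k ab le_prod_encode_1[of a b] le_prod_encode_2[of b a] by linarith+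
      then obtain p q r where pqr: "goedel p = a" "goedel q = b" "goedel r = k"
        using less.IH k by metis
      have "n = 4 + 4 * k \<or> n = 5 + 4 * k \<or> n = 6 + 4 * k \<or> n = 7 + 4 * k"
        using False unfolding k_def by presburger
      then consider "n = 4 + 4 * k" | "n = 5 + 4 * k" | "n = 6 + 4 * k" | "n = 7 + 4 * k"
        by blast
      then show ?thesis
        using pqr ab by cases (metis goedel.simps)+
    qed
  qed
  then show ?thesis by (metis surjI)
qed

lemma bij_goedel: "bij goedel"
  using inj_goedel surj_goedel by (rule bijI)

text \<open>The standard enumeration; every natural number is the index of a unique program.\<close>

definition phi :: "nat \<Rightarrow> nat \<Rightarrow> nat option" where
  "phi e = prog_sem (inv goedel e)"

definition total_computable :: "(nat \<Rightarrow> nat) \<Rightarrow> bool" where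
  "total_computable f \<longleftrightarrow> (\<exists>e. \<forall>x. phi e x = Some (f x))"

definition computably_reducible :: "(nat \<Rightarrow> nat \<Rightarrow> bool) \<Rightarrow> (nat \<Rightarrow> nat \<Rightarrow> bool) \<Rightarrow> bool"
    (infix "\<le>\<^sub>c" 50) where
  "R \<le>\<^sub>c S \<longleftrightarrow> (\<exists>f. total_computable f \<and> (\<forall>x y. R x y \<longleftrightarrow> S (f x) (f y)))"

definition H :: "nat \<Rightarrow> nat \<Rightarrow> bool" where
  "H x y \<longleftrightarrow> x = y \<or> (\<exists>v. phi x x = Some v \<and> phi y y = Some v)"

definition halting_jump :: "(nat \<Rightarrow> nat \<Rightarrow> bool) \<Rightarrow> nat \<Rightarrow> nat \<Rightarrow> bool" where
  "halting_jump E x y \<longleftrightarrow>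
     x = y \<or> (\<exists>u v. phi x x = Some u \<and> phi y y = Some v \<and> E u v)"

definition saturation :: "(nat \<Rightarrow> nat \<Rightarrow> bool) \<Rightarrow> nat set \<Rightarrow> nat set" where
  "saturation E X = {y. \<exists>x\<in>X. E x y}"

text \<open>
  Finite subsets of \<open>\<nat>\<close> are identified with natural numbers by their binary (canonical) index:
  \<open>set_decode\<close> is a bijection from \<open>\<nat>\<close> onto the finite sets.
\<close>

definition saturation_jump :: "(nat \<Rightarrow> nat \<Rightarrow> bool) \<Rightarrow> nat \<Rightarrow> nat \<Rightarrow> bool" where
  "saturation_jump E x y \<longleftrightarrow> saturation E (set_decode x) = saturation E (set_decode y)"

end

theory Submission
  imports Defs
begin

text \<open>
  No \<open>H\<^sup>+\<close>-class of a finite set \<open>X\<close> containing \<open>0\<close> is decidable: given a decision procedure, let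
  program \<open>e \<notin> X\<close> on input \<open>e\<close> diverge if \<open>X \<union> {e}\<close> is declared equivalent to \<open>X\<close>, and output
  \<open>0 = \<phi>\<^sub>0(0)\<close> otherwise. Hence, if \<open>f\<close> reduces \<open>H\<^sup>+\<close>, restricted to sets containing \<open>0\<close>, to a halting
  jump \<open>E'\<close>, then \<open>\<phi>\<^bsub>f(X)\<^esub>(f(X))\<close> always converges, since otherwise the class of \<open>X\<close> would be the
  decidable set \<open>f\<^sup>-\<^sup>1(f(X))\<close>; so \<open>X \<mapsto> \<phi>\<^bsub>f(X)\<^esub>(f(X))\<close> is a reduction to \<open>E\<close>.
  As \<open>H\<close> is the halting jump of equality, descending leads to a reduction to equality, which would
  again make the classes decidable.
\<close>

section \<open>Total recursive functions\<close>

abbreviation pr :: "nat \<Rightarrow> nat \<Rightarrow> nat" where "pr a b \<equiv> prod_encode (a, b)"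
abbreviation p1 :: "nat \<Rightarrow> nat" where "p1 x \<equiv> fst (prod_decode x)"
abbreviation p2 :: "nat \<Rightarrow> nat" where "p2 x \<equiv> snd (prod_decode x)"

definition recursive :: "(nat \<Rightarrow> nat) \<Rightarrow> bool" where
  "recursive f \<longleftrightarrow> (\<exists>p. \<forall>x. prog_sem p x = Some (f x))"

lemma recursiveI: "(\<And>x. prog_sem p x = Some (f x)) \<Longrightarrow> recursive f"
  by (auto simp: recursive_def)

lemma recursiveE:
  assumes "recursive f"
  obtains p where "prog_sem p = (\<lambda>x. Some (f x))"
  using assms by (auto simp: recursive_def fun_eq_iff)

lemma recursive_id: "recursive (\<lambda>x. x)"
  by (rule recursiveI[of "PairP Fst Snd"]) simp

lemma recursive_Suc:
  assumes "recursive f" shows "recursive (\<lambda>x. Suc (f x))"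
proof -
  obtain p where "prog_sem p = (\<lambda>x. Some (f x))" using assms by (rule recursiveE)
  then show ?thesis by (intro recursiveI[of "Comp Succ p"]) simp
qed

fun const_prog :: "nat \<Rightarrow> prog" where
  "const_prog 0 = Zero"
| "const_prog (Suc n) = Comp Succ (const_prog n)"

lemma prog_sem_const_prog: "prog_sem (const_prog n) x = Some n"
  by (induction n) auto

lemma recursive_const: "recursive (\<lambda>x. c)"
  by (rule recursiveI[OF prog_sem_const_prog])

lemma recursive_p1:
  assumes "recursive f" shows "recursive (\<lambda>x. p1 (f x))"
proof -
  obtain p where "prog_sem p = (\<lambda>x. Some (f x))" using assms by (rule recursiveE)
  then show ?thesis by (intro recursiveI[of "Comp Fst p"]) simp
qed

lemma recursive_p2:
  assumes "recursive f" shows "recursive (\<lambda>x. p2 (f x))"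
proof -
  obtain p where "prog_sem p = (\<lambda>x. Some (f x))" using assms by (rule recursiveE)
  then show ?thesis by (intro recursiveI[of "Comp Snd p"]) simp
qed

lemma recursive_pr:
  assumes "recursive f" "recursive g" shows "recursive (\<lambda>x. pr (f x) (g x))"
proof -
  obtain p where "prog_sem p = (\<lambda>x. Some (f x))" using assms(1) by (rule recursiveE)
  moreover obtain q where "prog_sem q = (\<lambda>x. Some (g x))" using assms(2) by (rule recursiveE)
  ultimately show ?thesis by (intro recursiveI[of "PairP p q"]) simp
qed

lemma recursive_compose:
  assumes "recursive f" "recursive g" shows "recursive (\<lambda>x. f (g x))"
proof -
  obtain p where "prog_sem p = (\<lambda>x. Some (f x))" using assms(1) by (rule recursiveE)
  moreover obtain q where "prog_sem q = (\<lambda>x. Some (g x))" using assms(2) by (rule recursiveE)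
  ultimately show ?thesis by (intro recursiveI[of "Comp p q"]) simp
qed

text \<open>\<open>PrimRec\<close> passes its parameter unchanged to every round; taking the whole
  input \<open>x\<close> as parameter and \<open>k x\<close> as the number of rounds lets base, step
  and bound all depend on \<open>x\<close>.\<close>

lemma recursive_rec_nat:
  assumes "recursive b" "recursive (\<lambda>z. s (p1 z) (p1 (p2 z)) (p2 (p2 z)))" "recursive k"
  shows "recursive (\<lambda>x. rec_nat (b x) (s x) (k x))"
proof -
  obtain p where p: "prog_sem p = (\<lambda>x. Some (b x))" using assms(1) by (rule recursiveE)
  obtain q where q: "prog_sem q = (\<lambda>z. Some (s (p1 z) (p1 (p2 z)) (p2 (p2 z))))"
    using assms(2) by (rule recursiveE)
  have "rec_nat (prog_sem p a) (\<lambda>i r. Option.bind r (\<lambda>v. prog_sem q (pr a (pr i v)))) n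
      = Some (rec_nat (b a) (s a) n)" for a n
    by (induction n) (simp_all add: p q)
  then have "recursive (\<lambda>z. rec_nat (b (p1 z)) (s (p1 z)) (p2 z))"
    by (intro recursiveI[of "PrimRec p q"]) (simp add: case_prod_beta)
  then have "recursive (\<lambda>x. rec_nat (b (p1 (pr x (k x)))) (s (p1 (pr x (k x)))) (p2 (pr x (k x))))"
    by (rule recursive_compose) (intro recursive_pr recursive_id assms)
  then show ?thesis by simp
qed

lemma recursive_add:
  assumes "recursive f" "recursive g" shows "recursive (\<lambda>x. f x + g x)"
proof -
  have "rec_nat a (\<lambda>i v. Suc v) b = a + b" for a b :: nat by (induction b) auto
  moreover have "recursive (\<lambda>x. rec_nat (f x) (\<lambda>i v. Suc v) (g x))"
    by (intro recursive_rec_nat recursive_Suc recursive_p2 recursive_id assms)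
  ultimately show ?thesis by simp
qed

lemma recursive_diff:
  assumes "recursive f" "recursive g" shows "recursive (\<lambda>x. f x - g x)"
proof -
  \<comment> \<open>Predecessor as a recursion that discards its accumulator and keeps the last
    round number.\<close>
  have pred: "rec_nat 0 (\<lambda>i v. i) a = a - 1" for a :: nat by (cases a) auto
  have "recursive (\<lambda>x. rec_nat 0 (\<lambda>i v. i) (p2 (p2 x)))"
    by (intro recursive_rec_nat recursive_const recursive_p1 recursive_p2 recursive_id)
  then have "recursive (\<lambda>x. rec_nat (f x) (\<lambda>i v. v - 1) (g x))"
    unfolding pred by (intro recursive_rec_nat assms)
  moreover have "rec_nat a (\<lambda>i v. v - 1) b = a - b" for a b :: nat by (induction b) auto
  ultimately show ?thesis by simp
qed

text \<open>The two truncated differences sum to zero exactly when the values agree; a recursion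
  whose step ignores the accumulator then selects the branch.\<close>

lemma recursive_if_eq:
  assumes "recursive f" "recursive k" "recursive g" "recursive h"
  shows "recursive (\<lambda>x. if f x = k x then g x else h x)"
proof -
  have "rec_nat a (\<lambda>i v. b) n = (if n = 0 then a else b)" for a b n :: nat by (cases n) auto
  moreover have "recursive (\<lambda>z. h (p1 z))"
    by (intro recursive_compose[OF assms(4)] recursive_p1 recursive_id)
  then have "recursive (\<lambda>x. rec_nat (g x) (\<lambda>i v. h x) ((f x - k x) + (k x - f x)))"
    by (intro recursive_rec_nat recursive_add recursive_diff assms)
  moreover have "a - b + (b - a) = 0 \<longleftrightarrow> a = b" for a b :: nat by arith
  ultimately show ?thesis by (simp only:)
qed

lemma recursive_pow2:
  assumes "recursive f" shows "recursive (\<lambda>x. 2 ^ f x)"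
proof -
  have "rec_nat 1 (\<lambda>i v. v + v) n = (2::nat) ^ n" for n by (induction n) auto
  moreover have "recursive (\<lambda>x. rec_nat 1 (\<lambda>i v. v + v) (f x))"
    by (intro recursive_rec_nat recursive_const recursive_add recursive_p2 recursive_id assms)
  ultimately show ?thesis by simp
qed

lemma recursive_mod4:
  assumes "recursive f" shows "recursive (\<lambda>x. f x mod 4)"
proof -
  have "rec_nat 0 (\<lambda>i v. if v = 3 then 0 else Suc v) n = n mod 4" for n :: nat
    by (induction n) (auto simp: mod_Suc)
  moreover have "recursive (\<lambda>x. rec_nat 0 (\<lambda>i v. if v = 3 then 0 else Suc v) (f x))"
    by (intro recursive_rec_nat recursive_const recursive_if_eq recursive_Suc recursive_p2
        recursive_id assms)
  ultimately show ?thesis by simp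
qed

lemma recursive_div4:
  assumes "recursive f" shows "recursive (\<lambda>x. f x div 4)"
proof -
  \<comment> \<open>The quotient counts the \<open>i < n\<close> with
    \<open>i mod 4 = 3\<close>.\<close>
  have "rec_nat 0 (\<lambda>i v. if i mod 4 = 3 then Suc v else v) n = n div 4" for n :: nat
    by (induction n) (auto simp: div_Suc mod_Suc)
  moreover have "recursive (\<lambda>x. rec_nat 0 (\<lambda>i v. if i mod 4 = 3 then Suc v else v) (f x))"
    by (intro recursive_rec_nat recursive_const recursive_if_eq recursive_Suc recursive_p2
        recursive_p1 recursive_mod4 recursive_id assms)
  ultimately show ?thesis by simp
qed

lemmas recursive_intros =
  recursive_id recursive_const recursive_Suc recursive_p1 recursive_p2 recursive_pr
  recursive_add recursive_diff recursive_if_eq recursive_pow2 recursive_mod4 recursive_div4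

section \<open>A universal program\<close>

text \<open>
  States of a stack machine are pairs \<open>pr k v\<close> of a continuation stack \<open>k\<close> (\<open>0\<close> is empty) and the
  current value \<open>v\<close>. A frame is a tag with data; the tags mean: \<open>0\<close> run the program with index \<open>d\<close> on
  \<open>v\<close>; \<open>1\<close> run the second component of a pair; \<open>2\<close> form the pair; \<open>3\<close> continue a primitive recursion,
  with data \<open>(q, a, i, m)\<close> where \<open>m\<close> is the number of remaining rounds; \<open>4\<close> continue a search, with
  data \<open>(p, x, n)\<close>.
\<close>

abbreviation push :: "nat \<Rightarrow> nat \<Rightarrow> nat \<Rightarrow> nat" where
  "push t d k \<equiv> Suc (pr (pr t d) k)"

definition run :: "nat \<Rightarrow> nat \<Rightarrow> nat \<Rightarrow> nat" where
  "run e v k =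
     (if e = 0 then pr k 0
      else if e = 1 then pr k (Suc v)
      else if e = 2 then pr k (p1 v)
      else if e = 3 then pr k (p2 v)
      else if e mod 4 = 0 then
        pr (push 0 (p1 ((e - 4) div 4)) (push 1 (pr (p2 ((e - 4) div 4)) v) k)) v
      else if e mod 4 = 1 then
        pr (push 0 (p2 ((e - 4) div 4)) (push 0 (p1 ((e - 4) div 4)) k)) v
      else if e mod 4 = 2 then
        pr (push 0 (p1 ((e - 4) div 4))
             (push 3 (pr (p2 ((e - 4) div 4)) (pr (p1 v) (pr 0 (p2 v)))) k)) (p1 v)
      else
        pr (push 0 ((e - 4) div 4) (push 4 (pr ((e - 4) div 4) (pr v 0)) k)) (pr v 0))"

definition resume :: "nat \<Rightarrow> nat \<Rightarrow> nat \<Rightarrow> nat \<Rightarrow> nat" where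
  "resume t d v k =
     (if t = 0 then run d v k
      else if t = 1 then pr (push 0 (p1 d) (push 2 v k)) (p2 d)
      else if t = 2 then pr k (pr d v)
      else if t = 3 then
        (if p2 (p2 (p2 d)) = 0 then pr k v
         else pr (push 0 (p1 d)
                (push 3 (pr (p1 d) (pr (p1 (p2 d))
                   (pr (Suc (p1 (p2 (p2 d)))) (p2 (p2 (p2 d)) - 1)))) k))
                (pr (p1 (p2 d)) (pr (p1 (p2 (p2 d))) v)))
      else
        (if v = 0 then pr k (p2 (p2 d))
         else pr (push 0 (p1 d) (push 4 (pr (p1 d) (pr (p1 (p2 d)) (Suc (p2 (p2 d))))) k))
                (pr (p1 (p2 d)) (Suc (p2 (p2 d))))))"

text \<open>States with empty stack are fixed points, so running past the halting time does no harm.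
  The \<open>- 1\<close> removes the \<open>Suc\<close> of \<open>push\<close>.\<close>

definition step :: "nat \<Rightarrow> nat" where
  "step s = (if p1 s = 0 then s
     else resume (p1 (p1 (p1 s - 1))) (p2 (p1 (p1 s - 1))) (p2 s) (p2 (p1 s - 1)))"

lemma recursive_step: "recursive step"
proof -
  have "recursive (\<lambda>s. step s)"
    unfolding step_def resume_def run_def by (intro recursive_intros)
  then show ?thesis by simp
qed

lemma step_push: "step (pr (push t d k) v) = resume t d v k"
  by (simp add: step_def)

lemma run_goedel:
  "run (goedel Zero) v k = pr k 0"
  "run (goedel Succ) v k = pr k (Suc v)"
  "run (goedel Fst) v k = pr k (p1 v)"
  "run (goedel Snd) v k = pr k (p2 v)"
  "run (goedel (PairP p q)) v k = pr (push 0 (goedel p) (push 1 (pr (goedel q) v) k)) v"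
  "run (goedel (Comp p q)) v k = pr (push 0 (goedel q) (push 0 (goedel p) k)) v"
  "run (goedel (PrimRec p q)) v k =
     pr (push 0 (goedel p) (push 3 (pr (goedel q) (pr (p1 v) (pr 0 (p2 v)))) k)) (p1 v)"
  "run (goedel (Mu p)) v k = pr (push 0 (goedel p) (push 4 (pr (goedel p) (pr v 0)) k)) (pr v 0)"
proof -
  have mods: "(5 + 4 * c) mod 4 = 1" "(6 + 4 * c) mod 4 = 2" "(7 + 4 * c) mod 4 = 3"
    and divs: "(1 + 4 * c) div 4 = c" "(2 + 4 * c) div 4 = c" "(3 + 4 * c) div 4 = c" for c :: nat
    by presburger+
  show "run (goedel (PairP p q)) v k = pr (push 0 (goedel p) (push 1 (pr (goedel q) v) k)) v"
    "run (goedel (Comp p q)) v k = pr (push 0 (goedel q) (push 0 (goedel p) k)) v"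
    "run (goedel (PrimRec p q)) v k =
       pr (push 0 (goedel p) (push 3 (pr (goedel q) (pr (p1 v) (pr 0 (p2 v)))) k)) (p1 v)"
    "run (goedel (Mu p)) v k = pr (push 0 (goedel p) (push 4 (pr (goedel p) (pr v 0)) k)) (pr v 0)"
    unfolding run_def goedel.simps using mods divs by simp_all
qed (simp_all add: run_def)

section \<open>Correctness of the stack machine on converging computations\<close>

definition reach :: "nat \<Rightarrow> nat \<Rightarrow> bool" where
  "reach s t \<longleftrightarrow> (\<exists>n. (step ^^ n) s = t)"

lemma reach_refl: "reach s s"
  unfolding reach_def by (metis funpow_0)

lemma reach_trans: "reach s t \<Longrightarrow> reach t u \<Longrightarrow> reach s u"
  unfolding reach_def by (metis funpow_add comp_apply)

lemma reach_push: "reach (resume t d v k) u \<Longrightarrow> reach (pr (push t d k) v) u"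
  unfolding reach_def by (metis step_push funpow_Suc_right comp_apply)

text \<open>Induction on the number \<open>m\<close> of remaining rounds; the invariant is that the
  current value is the \<open>i\<close>-th stage \<open>r i\<close>.\<close>

lemma reach_PrimRec:
  assumes q: "\<And>x v k. prog_sem q x = Some v \<Longrightarrow> reach (pr (push 0 (goedel q) k) x) (pr k v)"
    and r: "r = (\<lambda>n. rec_nat b (\<lambda>i r. Option.bind r (\<lambda>v. prog_sem q (pr a (pr i v)))) n)"
    and "r i = Some v" "r (i + m) = Some w"
  shows "reach (pr (push 3 (pr (goedel q) (pr a (pr i m))) k) v) (pr k w)"
  using assms(3,4)
proof (induction m arbitrary: i v)
  case 0
  then show ?case by (intro reach_push) (simp add: resume_def reach_refl)
next
  case (Suc m)
  \<comment> \<open>A diverging stage would make all later stages diverge, including stage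
    \<open>i + Suc m\<close>.\<close>
  have "r (Suc i) \<noteq> None"
  proof
    assume "r (Suc i) = None"
    then have "r (Suc i + j) = None" for j by (induction j) (auto simp: r)
    with Suc.prems(2) show False by simp
  qed
  then obtain u where u: "r (Suc i) = Some u" by blast
  then have "prog_sem q (pr a (pr i v)) = Some u" using Suc.prems(1) by (simp add: r)
  from reach_trans[OF q[OF this] Suc.IH[OF u]] show ?case
    using Suc.prems(2) by (intro reach_push) (simp add: resume_def)
qed

text \<open>Induction on the distance \<open>m\<close> from the current candidate \<open>i\<close>
  to the first zero.\<close>

lemma reach_Mu:
  assumes p: "\<And>x v k. prog_sem p x = Some v \<Longrightarrow> reach (pr (push 0 (goedel p) k) x) (pr k v)"
    and zero: "prog_sem p (pr x (i + m)) = Some 0"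
    and nonzero: "\<And>j. j < i + m \<Longrightarrow> \<exists>v. prog_sem p (pr x j) = Some (Suc v)"
  shows "reach (pr (push 0 (goedel p) (push 4 (pr (goedel p) (pr x i)) k)) (pr x i)) (pr k (i + m))"
  using zero nonzero
proof (induction m arbitrary: i)
  case 0
  have "reach (pr (push 4 (pr (goedel p) (pr x i)) k) 0) (pr k i)"
    by (intro reach_push) (simp add: resume_def reach_refl)
  with 0 show ?case using reach_trans[OF p] by simp
next
  case (Suc m)
  obtain v where v: "prog_sem p (pr x i) = Some (Suc v)" using Suc.prems(2)[of i] by auto
  have "reach (pr (push 4 (pr (goedel p) (pr x i)) k) (Suc v)) (pr k (i + Suc m))"
    using Suc.IH[of "Suc i"] Suc.prems by (intro reach_push) (simp add: resume_def)
  with v show ?case using reach_trans[OF p] by blast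
qed

text \<open>The stack \<open>k\<close> stays arbitrary in the induction because subprograms run on
  top of the frames of their caller.\<close>

lemma reach_prog_sem:
  "prog_sem p x = Some v \<Longrightarrow> reach (pr (push 0 (goedel p) k) x) (pr k v)"
proof (induction p arbitrary: x v k)
  case (PairP p q)
  then obtain a b where a: "prog_sem p x = Some a" and b: "prog_sem q x = Some b"
    and v: "v = pr a b"
    by (auto simp: bind_eq_Some_conv)
  have "reach (pr (push 2 a k) b) (pr k v)"
    by (intro reach_push) (simp add: resume_def reach_refl v)
  from reach_trans[OF PairP.IH(2)[OF b] this]
  have "reach (pr (push 1 (pr (goedel q) x) k) a) (pr k v)"
    by (intro reach_push) (simp add: resume_def)
  from reach_trans[OF PairP.IH(1)[OF a] this]
  show ?case by (intro reach_push) (simp add: resume_def run_goedel del: goedel.simps)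
next
  case (Comp p q)
  then obtain a where a: "prog_sem q x = Some a" and b: "prog_sem p a = Some v"
    by (auto simp: bind_eq_Some_conv)
  from reach_trans[OF Comp.IH(2)[OF a] Comp.IH(1)[OF b]]
  show ?case by (intro reach_push) (simp add: resume_def run_goedel del: goedel.simps)
next
  case (PrimRec p q)
  define r where "r = (\<lambda>n. rec_nat (prog_sem p (p1 x))
    (\<lambda>i r. Option.bind r (\<lambda>v. prog_sem q (pr (p1 x) (pr i v)))) n)"
  have v: "r (p2 x) = Some v" using PrimRec.prems by (simp add: r_def case_prod_beta)
  have "r 0 \<noteq> None"
  proof
    assume "r 0 = None"
    then have "r n = None" for n by (induction n) (auto simp: r_def)
    with v show False by simp
  qed
  then obtain u where u: "r 0 = Some u" by blast
  then have pu: "prog_sem p (p1 x) = Some u" by (simp add: r_def)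
  have "reach (pr (push 3 (pr (goedel q) (pr (p1 x) (pr 0 (p2 x)))) k) u) (pr k v)"
    using v by (intro reach_PrimRec[OF PrimRec.IH(2) r_def u]) auto
  from reach_trans[OF PrimRec.IH(1)[OF pu] this]
  show ?case by (intro reach_push) (simp add: resume_def run_goedel del: goedel.simps)
next
  case (Mu p)
  let ?Z = "\<lambda>n. prog_sem p (pr x n) = Some 0"
  \<comment> \<open>This zero need not be the least one, but the least one lies at or below it, so
    all values before the least zero converge.\<close>
  obtain n where n: "?Z n" "\<And>m. m < n \<Longrightarrow> prog_sem p (pr x m) \<noteq> None" and v: "v = (LEAST n. ?Z n)"
    using Mu.prems by (auto split: if_splits)
  have "?Z v" "v \<le> n" unfolding v using n(1) by (auto intro: LeastI Least_le)
  moreover have "\<exists>w. prog_sem p (pr x j) = Some (Suc w)" if "j < v" for j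
  proof -
    have "\<not> ?Z j" using that not_less_Least unfolding v by blast
    moreover have "prog_sem p (pr x j) \<noteq> None" using that \<open>v \<le> n\<close> n(2) by simp
    ultimately show ?thesis using not0_implies_Suc by fastforce
  qed
  ultimately have
    "reach (pr (push 0 (goedel p) (push 4 (pr (goedel p) (pr x 0)) k)) (pr x 0)) (pr k (0 + v))"
    by (intro reach_Mu[OF Mu.IH]) auto
  then show ?case by (intro reach_push) (simp add: resume_def run_goedel del: goedel.simps)
qed (intro reach_push, simp add: resume_def run_def reach_refl)+

text \<open>
  The behaviour of the universal program outside the halting set is irrelevant for the descent, so
  it suffices that the machine simulates converging computations.
\<close>

lemma universal_program: "\<exists>u. \<forall>x v. phi x x = Some v \<longrightarrow> prog_sem u x = Some v"
proof -
  define it where "it x n = (step ^^ n) (pr (push 0 x 0) x)" for x n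
  have it: "it x n = rec_nat (pr (push 0 x 0) x) (\<lambda>i v. step v) n" for x n
    by (induction n) (auto simp: it_def)
  have rec_it: "recursive (\<lambda>z. it (p1 z) (p2 z))"
    unfolding it
    by (intro recursive_rec_nat recursive_compose[OF recursive_step] recursive_intros)
  obtain h where h: "prog_sem h = (\<lambda>z. Some (p1 (it (p1 z) (p2 z))))"
    using recursive_p1[OF rec_it] by (rule recursiveE)
  obtain t where t: "prog_sem t = (\<lambda>z. Some (p2 (it (p1 z) (p2 z))))"
    using recursive_p2[OF rec_it] by (rule recursiveE)
  \<comment> \<open>\<open>Mu h\<close> finds the first time at which the stack is empty, and
    \<open>t\<close> reads off the value at that time.\<close>
  have "prog_sem (Comp t (PairP (PairP Fst Snd) (Mu h))) x = Some v" if "phi x x = Some v" for x v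
  proof -
    obtain p where p: "x = goedel p" using surj_goedel by (metis surjD)
    then have "prog_sem p x = Some v" using that by (simp add: phi_def inj_goedel)
    then obtain n where n: "it x n = pr 0 v"
      using reach_prog_sem[of p x v 0] p by (auto simp: reach_def it_def)
    define l where "l = (LEAST n. p1 (it x n) = 0)"
    have l: "p1 (it x l) = 0" "l \<le> n"
      unfolding l_def by (rule LeastI[of _ n], simp add: n) (rule Least_le, simp add: n)
    have "it x (l + j) = it x l" for j
      by (induction j) (use l(1) in \<open>auto simp: it_def step_def\<close>)
    from this[of "n - l"] have "it x l = pr 0 v" using n l(2) by simp
    moreover have "\<exists>n. p1 (it x n) = 0" using l(1) by blast
    ultimately show ?thesis by (simp add: h t l_def)
  qed
  then show ?thesis by blast
qed

section \<open>Undecidability of the classes\<close>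

text \<open>Padding: \<open>p\<close> is precomposed with identities that compute and discard a
  constant \<open>i\<close>. This lets the diagonal program have an index outside a given finite
  set.\<close>

lemma infinite_indices: "infinite {goedel q |q. prog_sem q = prog_sem p}"
proof -
  define pad where "pad i = Comp p (Comp Fst (PairP (PairP Fst Snd) (const_prog i)))" for i
  have inj: "inj const_prog"
    by (rule injI) (metis prog_sem_const_prog option.inject)
  have "inj (\<lambda>i. goedel (pad i))"
    by (rule injI) (simp add: pad_def inj_eq[OF inj] inj_eq[OF inj_goedel] del: goedel.simps)
  then have "infinite (range (\<lambda>i. goedel (pad i)))" using finite_imageD infinite_UNIV_nat by blast
  moreover have "prog_sem (pad i) = prog_sem p" for i
    by (simp add: pad_def prog_sem_const_prog)
  then have "range (\<lambda>i. goedel (pad i)) \<subseteq> {goedel q |q. prog_sem q = prog_sem p}" by blast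
  ultimately show ?thesis using infinite_super by blast
qed

text \<open>By the binary coding of finite sets, \<open>odd x\<close> means \<open>0 \<in> set_decode x\<close>.\<close>

lemma saturation_jump_class_undecidable:
  assumes p: "\<And>y. odd y \<Longrightarrow> prog_sem p y = Some (g y)" and x: "odd x"
  shows "\<not> (\<forall>y. odd y \<longrightarrow> (saturation_jump H x y \<longleftrightarrow> g y = c))"
proof
  assume dec: "\<forall>y. odd y \<longrightarrow> (saturation_jump H x y \<longleftrightarrow> g y = c)"
  have "recursive (\<lambda>y. if y = c then 1 else 0)" by (intro recursive_intros)
  then obtain t where t: "prog_sem t = (\<lambda>y. Some (if y = c then 1 else 0))" by (rule recursiveE)
  have "recursive (\<lambda>z. x + 2 ^ p1 z)" by (intro recursive_intros)
  then obtain s where s: "prog_sem s = (\<lambda>z. Some (x + 2 ^ p1 z))" by (rule recursiveE)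
  \<comment> \<open>The tested value does not depend on the search counter, so the search stops at
    \<open>0\<close> immediately or never.\<close>
  let ?r = "Mu (Comp t (Comp p s))"
  have "\<not> {goedel q |q. prog_sem q = prog_sem ?r} \<subseteq> set_decode x"
    using infinite_indices finite_set_decode finite_subset by blast
  then obtain q where q: "prog_sem q = prog_sem ?r" "goedel q \<notin> set_decode x" by blast
  define e where "e = goedel q"
  have e: "e \<notin> set_decode x" using q(2) by (simp add: e_def)
  have zero: "0 \<in> set_decode x" using x by (simp add: set_decode_def)
  have "e \<noteq> 0" using e zero by metis
  define y where "y = x + 2 ^ e"
  have y: "odd y" using x \<open>e \<noteq> 0\<close> by (simp add: y_def)
  have dy: "set_decode y = insert e (set_decode x)"
    using set_decode_plus_power_2[OF e] by (simp add: y_def add.commute)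
  have "phi e e = prog_sem ?r e" using q(1) by (simp add: phi_def e_def inj_goedel)
  moreover have "prog_sem ?r e = (if g y = c then None else Some 0)"
  proof -
    have "prog_sem (Comp t (Comp p s)) (pr e m) = Some (if g y = c then 1 else 0)" for m
      using p[OF y] by (simp add: s t y_def)
    then show ?thesis unfolding prog_sem.simps(8) by auto
  qed
  ultimately have ee: "phi e e = (if g y = c then None else Some 0)" by simp
  show False
  proof (cases "g y = c")
    case True
    \<comment> \<open>Here \<open>e\<close> diverges on itself, so its \<open>H\<close>-class is a
      singleton and adding \<open>e\<close> must enlarge the saturation.\<close>
    then have "saturation H (set_decode x) = saturation H (insert e (set_decode x))"
      using dec y dy unfolding saturation_jump_def by metis
    moreover have "e \<in> saturation H (insert e (set_decode x))"
      by (simp add: saturation_def H_def)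
    ultimately have "e \<in> saturation H (set_decode x)" by simp
    then show False using ee e True by (auto simp: saturation_def H_def)
  next
    case False
    \<comment> \<open>Index \<open>0\<close> is the program \<open>Zero\<close>; so \<open>e\<close>
      is \<open>H\<close>-equivalent to \<open>0\<close>, which is already in the set.\<close>
    have "phi 0 0 = Some 0"
      unfolding phi_def by (metis goedel.simps(1) inj_goedel inv_f_f prog_sem.simps(1))
    then have "H e z \<Longrightarrow> z \<noteq> e \<Longrightarrow> H 0 z" "H 0 e" for z using ee False by (auto simp: H_def)
    then have "saturation H (set_decode y) = saturation H (set_decode x)"
      unfolding dy saturation_def using zero by blast
    then show False using dec y False by (auto simp: saturation_jump_def)
  qed
qed

section \<open>Descent through the halting jumps\<close>

text \<open>Convergence of the diagonal values is only obtained for sets containing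
  \<open>0\<close>, so the reducing program may be partial on even codes.\<close>

definition odd_reducible :: "(nat \<Rightarrow> nat \<Rightarrow> bool) \<Rightarrow> bool" where
  "odd_reducible E \<longleftrightarrow> (\<exists>p g. (\<forall>x. odd x \<longrightarrow> prog_sem p x = Some (g x)) \<and>
     (\<forall>x y. odd x \<longrightarrow> odd y \<longrightarrow> (saturation_jump H x y \<longleftrightarrow> E (g x) (g y))))"

lemma odd_reducible_eq: "\<not> odd_reducible (=)"
proof
  assume "odd_reducible (=)"
  then obtain p g where "\<And>x. odd x \<Longrightarrow> prog_sem p x = Some (g x)"
    and "\<And>x y. odd x \<Longrightarrow> odd y \<Longrightarrow> saturation_jump H x y \<longleftrightarrow> g x = g y"
    unfolding odd_reducible_def by blast
  then show False
    \<comment> \<open>The code \<open>1\<close> stands for the set {0}.\<close>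
    using saturation_jump_class_undecidable[of p g 1 "g 1"] by auto
qed

lemma odd_reducible_halting_jump:
  assumes "odd_reducible (halting_jump E)" and "reflp E"
  shows "odd_reducible E"
proof -
  obtain p g where p: "\<And>x. odd x \<Longrightarrow> prog_sem p x = Some (g x)"
    and red: "\<And>x y. odd x \<Longrightarrow> odd y \<Longrightarrow> saturation_jump H x y \<longleftrightarrow> halting_jump E (g x) (g y)"
    using assms(1) unfolding odd_reducible_def by blast
  obtain u where u: "\<And>x v. phi x x = Some v \<Longrightarrow> prog_sem u x = Some v"
    using universal_program by blast
  define h where "h x = the (phi (g x) (g x))" for x
  have h: "phi (g x) (g x) = Some (h x)" if "odd x" for x
  proof (rule ccontr)
    assume "phi (g x) (g x) \<noteq> Some (h x)"
    then have "phi (g x) (g x) = None" by (cases "phi (g x) (g x)") (simp_all add: h_def)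
    then have "saturation_jump H x y \<longleftrightarrow> g y = g x" if "odd y" for y
      using red[OF \<open>odd x\<close> that] by (auto simp: halting_jump_def)
    then show False using saturation_jump_class_undecidable[of p g x "g x"] p \<open>odd x\<close> by blast
  qed
  \<comment> \<open>Reflexivity of \<open>E\<close> covers the clause \<open>g x = g y\<close> of
    the jump.\<close>
  have "saturation_jump H x y \<longleftrightarrow> E (h x) (h y)" if "odd x" "odd y" for x y
    using red[OF that] h[OF that(1)] h[OF that(2)] reflpD[OF assms(2)]
    by (auto simp: halting_jump_def)
  moreover have "prog_sem (Comp u p) x = Some (h x)" if "odd x" for x
    using p h u that by simp
  ultimately show ?thesis unfolding odd_reducible_def by blast
qed

lemma H_eq_halting_jump: "H = halting_jump (=)"
  by (auto simp: fun_eq_iff H_def halting_jump_def)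

theorem theorem9p1:
  fixes n :: nat
  shows "\<not> saturation_jump H \<le>\<^sub>c (halting_jump ^^ n) H"
proof
  assume "saturation_jump H \<le>\<^sub>c (halting_jump ^^ n) H"
  then have "odd_reducible ((halting_jump ^^ n) H)"
    unfolding computably_reducible_def total_computable_def phi_def odd_reducible_def by blast
  moreover have "\<not> odd_reducible ((halting_jump ^^ n) H)"
  proof (induction n)
    case 0
    \<comment> \<open>Since \<open>H\<close> is itself a jump, the base case is one more descent,
      ending at equality.\<close>
    show ?case
      using odd_reducible_halting_jump[of "(=)"] odd_reducible_eq
      by (auto simp: H_eq_halting_jump reflp_def)
  next
    case (Suc n)
    have "reflp ((halting_jump ^^ n) H)"
      by (cases n) (auto simp: reflp_def H_def halting_jump_def)
    with Suc show ?case using odd_reducible_halting_jump by auto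
  qed
  ultimately show False by blast
qed

end
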